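(* Let $\mu,\sigma,M>0$, $\omega_1,\omega_2>0$ with $\omega_1+\omega_2=1$, $0<\delta_1<\delta_2$, and let $\theta_{i,j}$ be as in the context. Suppose $$\frac{\theta_{1,4}-\theta_{1,3}}{\theta_{2,1}}<\frac{\omega_2}{\omega_1},\qquad \frac{\theta_{2,4}-\theta_{2,3}}{\theta_{1,1}}<\frac{\omega_1}{\omega_2},$$ and $$\max\left\{\frac{2M}{\sigma^2(\theta_{1,2}+\theta_{1,3}-\theta_{1,4})},\ \frac{2M}{\sigma^2(\theta_{2,2}+\theta_{2,3}-\theta_{2,4})},\ \frac{1}{\sum_{i=1}^2\omega_i\frac{\theta_{i,3}+\theta_{i,4}}{\theta_{i,3}\mathrm{e}^{\theta_{i,3}x_{2,0}}+\theta_{i,4}\mathrm{e}^{-\theta_{i,4}x_{2,0}}}}\right\}<c<1,$$ where $x_{2,0}$ is the unique positive solution $x$ of $$\sum_{i=1}^2\omega_i\Big[-\frac{c}{\theta_{i,3}\mathrm{e}^{\theta_{i,3}x}+\theta_{i,4}\mathrm{e}^{-\theta_{i,4}x}}\big(\theta_{i,3}^2\mathrm{e}^{\theta_{i,3}x}-\theta_{i,4}^2\mathrm{e}^{-\theta_{i,4}x}\big)\Big]=0.$$ Then there exists a solution $0<x_1<x_2$ to the system $$\sum_{i=1}^2\omega_i\big(A_{i,1}\theta_{i,1}\mathrm{e}^{\theta_{i,1}x_1}-A_{i,2}\theta_{i,2}\mathrm{e}^{-\theta_{i,2}x_1}\big)=-1,\qquad \sum_{i=1}^2\omega_i\big(A_{i,3}\theta_{i,3}^2\mathrm{e}^{\theta_{i,3}x_2}+A_{i,4}\theta_{i,4}^2\mathrm{e}^{-\theta_{i,4}x_2}\big)=0,$$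 where $A_{i,j}=A_{i,j}(x_1,x_2)$ are the constants defined in the context.
   Context: For $i=1,2$: $\theta_{i,1}=\frac{-(\mu+M)+\sqrt{(\mu+M)^2+2\delta_i\sigma^2}}{\sigma^2}$, $\theta_{i,2}=\frac{\mu+M+\sqrt{(\mu+M)^2+2\delta_i\sigma^2}}{\sigma^2}$, $\theta_{i,3}=\frac{-\mu+\sqrt{\mu^2+2\delta_i\sigma^2}}{\sigma^2}$, $\theta_{i,4}=\frac{\mu+\sqrt{\mu^2+2\delta_i\sigma^2}}{\sigma^2}$. For $0<x_1<x_2$ and $i=1,2$, $A_{i,1},\dots,A_{i,5}$ (functions of $x_1,x_2$) are the unique solution of the linear system $\frac{M}{\delta_i}+A_{i,1}+A_{i,2}=0$; $\frac{M}{\delta_i}+A_{i,1}\mathrm{e}^{\theta_{i,1}x_1}+A_{i,2}\mathrm{e}^{-\theta_{i,2}x_1}=A_{i,3}\mathrm{e}^{\theta_{i,3}x_1}+A_{i,4}\mathrm{e}^{-\theta_{i,4}x_1}$; $A_{i,1}\theta_{i,1}\mathrm{e}^{\theta_{i,1}x_1}-A_{i,2}\theta_{i,2}\mathrm{e}^{-\theta_{i,2}x_1}=A_{i,3}\theta_{i,3}\mathrm{e}^{\theta_{i,3}x_1}-A_{i,4}\theta_{i,4}\mathrm{e}^{-\theta_{i,4}x_1}$; $A_{i,3}\mathrm{e}^{\theta_{i,3}x_2}+A_{i,4}\mathrm{e}^{-\theta_{i,4}x_2}=-cx_2+A_{i,5}$; $A_{i,3}\theta_{i,3}\mathrm{e}^{\theta_{i,3}x_2}-A_{i,4}\theta_{i,4}\mathrm{e}^{-\theta_{i,4}x_2}=-c$.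 *)

theory Defs
  imports "HOL-Analysis.Analysis" "HOL-Library.FuncSet"
begin

(* For j = 1, 2 (drift mu + M) and j = 3, 4 (drift mu), the exponents theta_j and -theta_(j+1), j odd,
   are the roots of sigma^2/2 * r^2 + drift * r - d = 0.  Values at indices outside 1..4 are irrelevant. *)
definition theta :: "real \<Rightarrow> real \<Rightarrow> real \<Rightarrow> real \<Rightarrow> nat \<Rightarrow> real" where
  "theta \<mu> \<sigma> M d j =
    (if j = 1 then (- (\<mu> + M) + sqrt ((\<mu> + M)\<^sup>2 + 2 * d * \<sigma>\<^sup>2)) / \<sigma>\<^sup>2
     else if j = 2 then (\<mu> + M + sqrt ((\<mu> + M)\<^sup>2 + 2 * d * \<sigma>\<^sup>2)) / \<sigma>\<^sup>2
     else if j = 3 then (- \<mu> + sqrt (\<mu>\<^sup>2 + 2 * d * \<sigma>\<^sup>2)) / \<sigma>\<^sup>2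
     else (\<mu> + sqrt (\<mu>\<^sup>2 + 2 * d * \<sigma>\<^sup>2)) / \<sigma>\<^sup>2)"

definition A_system ::
    "real \<Rightarrow> real \<Rightarrow> real \<Rightarrow> real \<Rightarrow> real \<Rightarrow> real \<Rightarrow> real \<Rightarrow> (nat \<Rightarrow> real) \<Rightarrow> bool" where
  "A_system \<mu> \<sigma> M d c x1 x2 a \<longleftrightarrow>
    (let t = theta \<mu> \<sigma> M d in
      M / d + a 1 + a 2 = 0 \<and>
      M / d + a 1 * exp (t 1 * x1) + a 2 * exp (- t 2 * x1)
        = a 3 * exp (t 3 * x1) + a 4 * exp (- t 4 * x1) \<and>
      a 1 * t 1 * exp (t 1 * x1) - a 2 * t 2 * exp (- t 2 * x1)
        = a 3 * t 3 * exp (t 3 * x1) - a 4 * t 4 * exp (- t 4 * x1) \<and>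
      a 3 * exp (t 3 * x2) + a 4 * exp (- t 4 * x2) = - c * x2 + a 5 \<and>
      a 3 * t 3 * exp (t 3 * x2) - a 4 * t 4 * exp (- t 4 * x2) = - c)"

(* A solution is a vector indexed by 1..5; extensionality fixes the values off that index set,
   which is what makes the solution unique as a function on nat. *)
definition A_coeff :: "real \<Rightarrow> real \<Rightarrow> real \<Rightarrow> real \<Rightarrow> real \<Rightarrow> real \<Rightarrow> real \<Rightarrow> nat \<Rightarrow> real" where
  "A_coeff \<mu> \<sigma> M d c x1 x2 =
    (THE a. a \<in> extensional {1..5} \<and> A_system \<mu> \<sigma> M d c x1 x2 a)"

definition x2_zero ::
    "real \<Rightarrow> real \<Rightarrow> real \<Rightarrow> (nat \<Rightarrow> real) \<Rightarrow> (nat \<Rightarrow> real) \<Rightarrow> real \<Rightarrow> real" where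
  "x2_zero \<mu> \<sigma> M \<omega> \<delta> c =
    (THE x. 0 < x \<and>
      (\<Sum>i = 1..2. \<omega> i *
        (let t = theta \<mu> \<sigma> M (\<delta> i) in
          - (c / (t 3 * exp (t 3 * x) + t 4 * exp (- t 4 * x)))
            * ((t 3)\<^sup>2 * exp (t 3 * x) - (t 4)\<^sup>2 * exp (- t 4 * x)))) = 0)"

end

theory Submission
  imports Defs
begin

text \<open>
  For each discount rate the five coefficients describe one function \<open>f\<close>, the negative of the
  piecewise exponential in the linear system. Put \<open>e = 2 * \<delta> / \<sigma>\<^sup>2\<close>, \<open>n = 2 * \<mu> / \<sigma>\<^sup>2\<close> and
  \<open>m = 2 * M / \<sigma>\<^sup>2\<close>. Then \<open>f\<close> is \<open>C\<^sup>1\<close> and solves \<open>f'' + (n + m) f' - e f = m\<close> on \<open>[0, x]\<close> and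
  \<open>f'' + n f' - e f = 0\<close> on \<open>[x, y]\<close>, where \<open>f 0 = 0\<close> and \<open>f' y = c\<close>. The two equations to solve say
  that the weighted means of \<open>f' x\<close> and of \<open>f'' y = e * f y - n * c\<close> are \<open>1\<close> and \<open>0\<close>; call these means
  \<open>mean_slope x y\<close> and \<open>curv x y\<close>. Both are continuous on the wedge \<open>0 \<le> x \<le> y\<close>.

  The heart of the argument is that, for fixed \<open>x\<close>, \<open>curv x y\<close> grows in \<open>y\<close> at a rate bounded away from
  \<open>0\<close> as long as it is not positive (\<open>dcurv_ge_gap\<close>). With \<open>h\<close> the homogeneous solution that has
  \<open>h 0 = 0\<close> and \<open>h' 0 = 1\<close>, the end value \<open>f y\<close> of
  the boundary value problem changes with \<open>y\<close> at the rate \<open>c - f'' y * (h y / h' y)\<close>. The lower bounds on \<open>c\<close>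
  give \<open>f y \<ge> 0\<close>, that is \<open>f'' y \<ge> - n * c\<close>, for both rates. If the weighted mean of the two \<open>f'' y\<close> is
  at most \<open>0\<close>, each of them is then bounded above in terms of the other, and the two conditions on the
  weights say exactly that this upper bound is less than \<open>c * \<theta>\<^sub>1\<close>, with \<open>\<theta>\<^sub>1\<close> taken at its own rate.
  Since \<open>h' \<ge> \<theta>\<^sub>1 * h\<close> (\<open>hom_growth\<close>), both rates are positive.

  So, for every \<open>x\<close>, \<open>curv x\<close> changes sign once on \<open>[x, \<infinity>)\<close>, at a point \<open>X x\<close> that depends continuously
  on \<open>x\<close>; when \<open>curv x x \<ge> 0\<close> this point is \<open>x\<close> itself. For \<open>x = 0\<close> it is the number \<open>x\<^sub>2\<^sub>,\<^sub>0\<close>, and the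
  third lower bound on \<open>c\<close> says that \<open>mean_slope 0 (X 0) > 1\<close>. For large \<open>x\<close> the first two lower bounds on
  \<open>c\<close> give \<open>curv x x \<ge> 0\<close>, hence \<open>X x = x\<close> and \<open>mean_slope x (X x) = c < 1\<close>. The intermediate value
  theorem along the curve \<open>(x, X x)\<close> yields the solution; it is off the diagonal because \<open>c \<noteq> 1\<close>
  (\<open>wedge_crossing\<close>).
\<close>

section \<open>Solutions of a linear equation with two real exponents\<close>

text \<open>\<open>phi p q\<close> is the solution of \<open>f'' + (q - p) f' - p q f = 0\<close> with \<open>f 0 = 0\<close> and \<open>f' 0 = 1\<close>, and
  \<open>dphi p q\<close> is its derivative. The solution with \<open>f 0 = 1\<close> and \<open>f' 0 = 0\<close> is \<open>dphi p q + (q - p) phi p q\<close>.\<close>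

definition phi :: "real \<Rightarrow> real \<Rightarrow> real \<Rightarrow> real" where
  "phi p q x = (exp (p * x) - exp (- q * x)) / (p + q)"

definition dphi :: "real \<Rightarrow> real \<Rightarrow> real \<Rightarrow> real" where
  "dphi p q x = (p * exp (p * x) + q * exp (- q * x)) / (p + q)"

lemma phi_0 [simp]: "phi p q 0 = 0"
  by (simp add: phi_def)

lemma dphi_0 [simp]: "p + q \<noteq> 0 \<Longrightarrow> dphi p q 0 = 1"
  by (simp add: dphi_def)

lemma DERIV_phi:
  assumes "p + q \<noteq> 0"
  shows "(phi p q has_real_derivative dphi p q x) (at x)"
  unfolding phi_def dphi_def using assms
  by (auto intro!: derivative_eq_intros simp: divide_simps)

lemma DERIV_dphi:
  assumes "p + q \<noteq> 0"
  shows "(dphi p q has_real_derivative p * q * phi p q x - (q - p) * dphi p q x) (at x)"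
  unfolding phi_def dphi_def using assms
  by (auto intro!: derivative_eq_intros simp: divide_simps) (simp add: algebra_simps)

lemma continuous_on_phi [continuous_intros]:
  "continuous_on A f \<Longrightarrow> continuous_on A (\<lambda>z. phi p q (f z))"
  unfolding phi_def divide_inverse by (intro continuous_intros)

lemma continuous_on_dphi [continuous_intros]:
  "continuous_on A f \<Longrightarrow> continuous_on A (\<lambda>z. dphi p q (f z))"
  unfolding dphi_def divide_inverse by (intro continuous_intros)

lemma phi_nonneg: "0 < p \<Longrightarrow> 0 < q \<Longrightarrow> 0 \<le> x \<Longrightarrow> 0 \<le> phi p q x"
  unfolding phi_def by (intro divide_nonneg_pos) (simp_all add: mult_nonneg_nonneg order.trans[of _ 0])

lemma dphi_pos: "0 < p \<Longrightarrow> 0 < q \<Longrightarrow> 0 < dphi p q x"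
  unfolding dphi_def by (intro divide_pos_pos add_pos_pos mult_pos_pos) simp_all

lemma dphi_minus_phi: "p + q \<noteq> 0 \<Longrightarrow> dphi p q x - p * phi p q x = exp (- q * x)"
  by (simp add: phi_def dphi_def divide_simps) algebra

text \<open>The left-hand side is the Wronskian of the two basic solutions, so it decays at the rate of the
  first-order coefficient and equals \<open>1\<close> at \<open>0\<close>.\<close>

lemma wronskian:
  assumes "p + q \<noteq> 0"
  shows "(dphi p q x)\<^sup>2 + (q - p) * dphi p q x * phi p q x - p * q * (phi p q x)\<^sup>2
    = exp ((p - q) * x)"
proof -
  define a b where "a = exp (p * x)" and "b = exp (- q * x)"
  have "exp ((p - q) * x) = a * b"
    by (simp add: a_def b_def algebra_simps flip: exp_add)
  moreover have "((p * a + q * b) / (p + q))\<^sup>2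
      + (q - p) * ((p * a + q * b) / (p + q)) * ((a - b) / (p + q))
      - p * q * ((a - b) / (p + q))\<^sup>2 = a * b"
    using assms by (simp add: divide_simps) algebra
  ultimately show ?thesis
    by (simp add: phi_def dphi_def a_def b_def)
qed

text \<open>The solution with \<open>f 0 = 1\<close> and \<open>f' 0 = 0\<close> is a convex combination of two exponentials; in
  \<open>exp z \<ge> 1 + z\<close> the linear terms cancel.\<close>

lemma even_solution_ge_1:
  assumes "0 < p" "0 < q"
  shows "1 \<le> dphi p q x + (q - p) * phi p q x"
proof -
  have eq: "dphi p q x + (q - p) * phi p q x = (q * exp (p * x) + p * exp (- q * x)) / (p + q)"
    using assms by (simp add: phi_def dphi_def divide_simps) algebra
  have "q * (1 + p * x) + p * (1 + - q * x) \<le> q * exp (p * x) + p * exp (- q * x)"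
    using assms by (intro add_mono mult_left_mono exp_ge_add_one_self) auto
  then show ?thesis
    unfolding eq using assms by (simp add: le_divide_eq algebra_simps)
qed

text \<open>This replaces the coefficients of a solution by its value \<open>u\<close> and slope \<open>v\<close> at \<open>x\<close>, which is how the
  matching conditions at the switching point enter.\<close>

lemma exponentials_from_initial_data:
  fixes a b p q x y :: real
  assumes "p + q \<noteq> 0"
    and u: "u = a * exp (p * x) + b * exp (- q * x)"
    and v: "v = a * p * exp (p * x) - b * q * exp (- q * x)"
  shows "a * exp (p * y) + b * exp (- q * y)
      = u * (dphi p q (y - x) + (q - p) * phi p q (y - x)) + v * phi p q (y - x)"
    and "a * p * exp (p * y) - b * q * exp (- q * y)
      = u * (p * q * phi p q (y - x)) + v * dphi p q (y - x)"
proof -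
  define A B C D where "A = exp (p * x)" and "B = exp (- q * x)"
    and "C = exp (p * (y - x))" and "D = exp (- q * (y - x))"
  have e: "exp (p * y) = A * C" "exp (- q * y) = B * D"
    by (simp_all add: A_def B_def C_def D_def algebra_simps flip: exp_add)
  show "a * exp (p * y) + b * exp (- q * y)
      = u * (dphi p q (y - x) + (q - p) * phi p q (y - x)) + v * phi p q (y - x)"
    unfolding e u v phi_def dphi_def A_def[symmetric] B_def[symmetric] C_def[symmetric] D_def[symmetric]
    using assms(1) by (simp add: divide_simps) algebra
  show "a * p * exp (p * y) - b * q * exp (- q * y)
      = u * (p * q * phi p q (y - x)) + v * dphi p q (y - x)"
    unfolding e u v phi_def dphi_def A_def[symmetric] B_def[symmetric] C_def[symmetric] D_def[symmetric]
    using assms(1) by (simp add: divide_simps) algebra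
qed

lemma tendsto_phi_over_dphi:
  assumes "0 < p" "0 < q"
  shows "((\<lambda>x. phi p q x / dphi p q x) \<longlongrightarrow> 1 / p) at_top"
proof -
  have eq: "phi p q x / dphi p q x = (1 - exp (- ((p + q) * x))) / (p + q * exp (- ((p + q) * x)))" for x
  proof -
    define C where "C = exp (p * x)"
    define z where "z = exp (- ((p + q) * x))"
    have "exp (- q * x) = C * z" by (simp add: C_def z_def algebra_simps flip: exp_add)
    moreover have "C > 0" "z > 0" by (simp_all add: C_def z_def)
    moreover have "p + q * z > 0" using assms \<open>z > 0\<close> by (simp add: add_pos_pos)
    moreover have "p * C + q * (C * z) = C * (p + q * z)" by algebra
    moreover have "C - C * z = C * (1 - z)" by algebra
    ultimately show ?thesis
      using assms by (simp add: phi_def dphi_def flip: C_def z_def)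
  qed
  have "((\<lambda>x. exp (- ((p + q) * x))) \<longlongrightarrow> 0) at_top"
    using assms
    by (intro filterlim_compose[OF exp_at_bot] filterlim_compose[OF filterlim_uminus_at_bot_at_top]
          filterlim_tendsto_pos_mult_at_top[OF tendsto_const] filterlim_ident) auto
  then have "((\<lambda>x. (1 - exp (- ((p + q) * x))) / (p + q * exp (- ((p + q) * x))))
      \<longlongrightarrow> (1 - 0) / (p + q * 0)) at_top"
    using assms by (intro tendsto_intros) auto
  then show ?thesis by (simp add: eq)
qed

section \<open>One discount rate\<close>

text \<open>\<open>p\<close>, \<open>- q\<close> are the exponents below the switching point \<open>x\<close> and \<open>r\<close>, \<open>- s\<close> those above it. The two
  equations have the same zeroth-order coefficient \<open>p * q = r * s\<close>, and the first-order coefficient is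
  larger below \<open>x\<close>.\<close>

locale two_drifts =
  fixes p q r s c :: real
  assumes pos: "0 < p" "0 < q" "0 < r" "0 < s" "0 < c"
    and prod_eq: "p * q = r * s"
    and drift: "r < s" "s - r < q - p"
begin

text \<open>The increase in drift is at the same time the inhomogeneity of the equation below \<open>x\<close>: with \<open>p * q\<close>
  for \<open>2 * \<delta> / \<sigma>\<^sup>2\<close>, the constant \<open>M / \<delta>\<close> is \<open>m / (p * q)\<close>.\<close>

definition m :: real where "m = (q - p) - (s - r)"

text \<open>For \<open>y \<ge> x\<close>, \<open>hom x y\<close> is the value at \<open>y\<close> of the \<open>C\<^sup>1\<close> solution of the homogeneous problem that
  has value \<open>0\<close> and slope \<open>1\<close> at \<open>0\<close>, and \<open>part x y\<close> that of the \<open>C\<^sup>1\<close> solution of the inhomogeneous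
  one with zero initial data; \<open>dhom\<close> and \<open>dpart\<close> are the derivatives in \<open>y\<close>. Each is
  expressed through its value and slope at the switching point.\<close>

definition hom :: "real \<Rightarrow> real \<Rightarrow> real" where
  "hom x y = phi p q x * (dphi r s (y - x) + (s - r) * phi r s (y - x))
    + dphi p q x * phi r s (y - x)"

definition dhom :: "real \<Rightarrow> real \<Rightarrow> real" where
  "dhom x y = phi p q x * (r * s * phi r s (y - x)) + dphi p q x * dphi r s (y - x)"

definition part :: "real \<Rightarrow> real \<Rightarrow> real" where
  "part x y = m / (p * q) * (dphi p q x + (q - p) * phi p q x - 1)
      * (dphi r s (y - x) + (s - r) * phi r s (y - x))
    + m * phi p q x * phi r s (y - x)"

definition dpart :: "real \<Rightarrow> real \<Rightarrow> real" where
  "dpart x y = m / (p * q) * (dphi p q x + (q - p) * phi p q x - 1) * (r * s * phi r s (y - x))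
    + m * phi p q x * dphi r s (y - x)"

text \<open>The Wronskian of \<open>part\<close> and \<open>hom\<close> (see \<open>wr_eq\<close>); above \<open>x\<close> it only decays exponentially.\<close>

definition wr :: "real \<Rightarrow> real \<Rightarrow> real" where
  "wr x y = m / (p * q) * (dphi p q x - exp ((p - q) * x)) * exp ((r - s) * (y - x))"

text \<open>The solution with \<open>f 0 = 0\<close> and slope \<open>c\<close> at \<open>y\<close> is \<open>part + b * hom\<close>, where
  \<open>b = (c - dpart x y) / dhom x y\<close>. Its value at \<open>y\<close> is \<open>val x y\<close>, and its slope at \<open>x\<close> is \<open>slope x y\<close>.\<close>

definition val :: "real \<Rightarrow> real \<Rightarrow> real" where
  "val x y = (c * hom x y - wr x y) / dhom x y"

definition slope :: "real \<Rightarrow> real \<Rightarrow> real" where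
  "slope x y = m * phi p q x + dphi p q x * ((c - dpart x y) / dhom x y)"

lemma m_pos: "0 < m"
  using drift by (simp add: m_def)

lemma p_less_r: "p < r"
proof (rule ccontr)
  assume "\<not> p < r"
  then have "r * s \<ge> r * q" using prod_eq pos by (metis mult_right_mono not_less less_imp_le)
  then have "q \<le> s" using pos by simp
  with \<open>\<not> p < r\<close> drift show False by simp
qed

lemma wr_eq: "dpart x y * hom x y - part x y * dhom x y = wr x y"
proof -
  define f f' g g' where "f = phi p q x" and "f' = dphi p q x"
    and "g = phi r s (y - x)" and "g' = dphi r s (y - x)"
  have nz: "p * q \<noteq> 0" "p + q \<noteq> 0" "r + s \<noteq> 0" using pos by auto
  note defs = f_def[symmetric] f'_def[symmetric] g_def[symmetric] g'_def[symmetric]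
  have w1: "exp ((p - q) * x) = f'\<^sup>2 + (q - p) * f' * f - p * q * f\<^sup>2"
    unfolding f_def f'_def using wronskian[of p q x] nz by simp
  have w2: "exp ((r - s) * (y - x)) = g'\<^sup>2 + (s - r) * g' * g - p * q * g\<^sup>2"
    unfolding g_def g'_def using wronskian[of r s "y - x"] nz prod_eq by simp
  define k where "k = m / (p * q)"
  have mk: "m = k * (p * q)" using nz by (simp add: k_def)
  show ?thesis
    unfolding wr_def dpart_def part_def hom_def dhom_def w1 w2 defs prod_eq[symmetric] k_def[symmetric]
    unfolding mk by algebra
qed

lemma dhom_pos: "0 \<le> x \<Longrightarrow> x \<le> y \<Longrightarrow> 0 < dhom x y"
  unfolding dhom_def using pos
  by (intro add_nonneg_pos mult_nonneg_nonneg mult_pos_pos phi_nonneg dphi_pos) auto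

lemma hom_nonneg: "0 \<le> x \<Longrightarrow> x \<le> y \<Longrightarrow> 0 \<le> hom x y"
  unfolding hom_def using pos drift
  by (intro add_nonneg_nonneg mult_nonneg_nonneg phi_nonneg less_imp_le[OF dphi_pos]) auto

text \<open>Below \<open>x\<close> the logarithmic derivative of the homogeneous solution decreases to \<open>p\<close>; above \<open>x\<close> it is
  attracted by \<open>r\<close>, which exceeds \<open>p\<close>. Hence it never falls below \<open>p\<close>.\<close>

lemma hom_growth:
  assumes "0 \<le> x" "x \<le> y"
  shows "p * hom x y \<le> dhom x y"
proof -
  define f f' g g' where "f = phi p q x" and "f' = dphi p q x"
    and "g = phi r s (y - x)" and "g' = dphi r s (y - x)"
  have f': "f' - p * f = exp (- q * x)"
    unfolding f_def f'_def using pos by (intro dphi_minus_phi) auto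
  have g': "g' - r * g = exp (- s * (y - x))"
    unfolding g_def g'_def using pos by (intro dphi_minus_phi) auto
  have nn: "0 \<le> f" "0 \<le> g"
    unfolding f_def g_def using pos assms by (auto intro!: phi_nonneg)
  have "p * g \<le> r * g" using nn p_less_r by (intro mult_right_mono) auto
  also have "\<dots> \<le> g'" using g' exp_gt_zero[of "- s * (y - x)"] by linarith
  \<comment> \<open>\<open>dhom - p * hom\<close> splits in this way because \<open>p * q - p * (s - r) - p\<^sup>2 = p * m\<close>\<close>
  finally have "0 \<le> f * (p * m * g) + (f' - p * f) * (g' - p * g)"
    using nn pos m_pos f' by (intro add_nonneg_nonneg mult_nonneg_nonneg) auto
  also have "\<dots> = dhom x y - p * hom x y"
    unfolding hom_def dhom_def f_def[symmetric] f'_def[symmetric] g_def[symmetric] g'_def[symmetric]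
      prod_eq[symmetric] m_def by algebra
  finally show ?thesis by simp
qed

text \<open>The Wronskian is at most \<open>m / q * phi p q x\<close> and \<open>hom x y\<close> is at least \<open>phi p q x\<close>, so
  \<open>c \<ge> m / q\<close> suffices; this follows from the lower bound on \<open>c\<close> because \<open>p + m = q - (s - r)\<close>.\<close>

lemma val_nonneg:
  assumes "m < c * (p + m)" and xy: "0 \<le> x" "x \<le> y"
  shows "0 \<le> val x y"
proof -
  define f f' g g' where "f = phi p q x" and "f' = dphi p q x"
    and "g = phi r s (y - x)" and "g' = dphi r s (y - x)"
  have nn: "0 \<le> f" "0 \<le> g" "0 < f'"
    unfolding f_def f'_def g_def using pos xy by (auto intro!: phi_nonneg dphi_pos)
  have f': "f' - p * f = exp (- q * x)"
    unfolding f_def f'_def using pos by (intro dphi_minus_phi) auto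
  have "exp (- q * x) \<le> exp ((p - q) * x)" using pos xy by (simp add: algebra_simps)
  with f' have le: "f' - exp ((p - q) * x) \<le> p * f" by linarith
  have "wr x y \<le> m / (p * q) * (p * f) * exp ((r - s) * (y - x))"
    unfolding wr_def f'_def[symmetric] using le m_pos pos
    by (intro mult_right_mono mult_left_mono) auto
  also have "\<dots> \<le> m / (p * q) * (p * f) * 1"
    using m_pos pos nn drift xy by (intro mult_left_mono) (auto simp: mult_nonpos_nonneg)
  also have "\<dots> = m / q * f" using pos by simp
  also have "\<dots> \<le> c * f"
  proof -
    have "p + m \<le> q" using drift by (simp add: m_def)
    then have "c * (p + m) \<le> c * q" using pos by simp
    with assms(1) have "m \<le> c * q" by linarith
    then show ?thesis using pos nn by (intro mult_right_mono) (auto simp: field_simps)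
  qed
  also have "\<dots> \<le> c * hom x y"
  proof -
    have "f * 1 \<le> f * (g' + (s - r) * g)"
      unfolding g_def g'_def using nn pos by (intro mult_left_mono even_solution_ge_1) auto
    moreover have "0 \<le> f' * g" using nn by simp
    ultimately show ?thesis
      unfolding hom_def f_def[symmetric] f'_def[symmetric] g_def[symmetric] g'_def[symmetric]
      using pos by (intro mult_left_mono) linarith+
  qed
  finally show ?thesis
    unfolding val_def using dhom_pos[OF xy] by simp
qed

text \<open>The factor \<open>p * q * val x y - (s - r) * c\<close> is the second derivative at \<open>y\<close> of the solution above \<open>x\<close>.
  Moving \<open>y\<close> changes the coefficient of \<open>hom\<close> at the rate of minus this factor divided by \<open>dhom\<close>.\<close>

lemma DERIV_val:
  assumes xy: "0 \<le> x" "x \<le> y"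
  shows "(val x has_real_derivative c - (p * q * val x y - (s - r) * c) * (hom x y / dhom x y)) (at y)"
proof -
  have rs: "r + s \<noteq> 0" using pos by auto
  have shift: "((\<lambda>y. y - x) has_real_derivative 1) (at y)"
    by (auto intro!: derivative_eq_intros)
  have D: "((\<lambda>y. phi r s (y - x)) has_real_derivative dphi r s (y - x)) (at y)"
    using DERIV_chain2[OF DERIV_phi[OF rs] shift] by simp
  have D': "((\<lambda>y. dphi r s (y - x)) has_real_derivative
      r * s * phi r s (y - x) - (s - r) * dphi r s (y - x)) (at y)"
    using DERIV_chain2[OF DERIV_dphi[OF rs] shift] by simp
  have h: "(hom x has_real_derivative dhom x y) (at y)"
    unfolding hom_def dhom_def
    by (rule derivative_eq_intros D D' refl)+ (simp add: algebra_simps)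
  have h': "(dhom x has_real_derivative p * q * hom x y - (s - r) * dhom x y) (at y)"
    unfolding hom_def dhom_def prod_eq
    by (rule derivative_eq_intros D D' refl)+ (simp add: algebra_simps)
  have w: "(wr x has_real_derivative (r - s) * wr x y) (at y)"
    unfolding wr_def using pos by (auto intro!: derivative_eq_intros)
  have nz: "dhom x y \<noteq> 0" using dhom_pos[OF xy] by simp
  have "(val x has_real_derivative ((c * dhom x y - (r - s) * wr x y) * dhom x y
      - (c * hom x y - wr x y) * (p * q * hom x y - (s - r) * dhom x y)) / (dhom x y * dhom x y)) (at y)"
    unfolding val_def using nz by (auto intro!: derivative_eq_intros h h' w)
  moreover have "((c * dhom x y - (r - s) * wr x y) * dhom x y
      - (c * hom x y - wr x y) * (p * q * hom x y - (s - r) * dhom x y)) / (dhom x y * dhom x y)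
    = c - (p * q * val x y - (s - r) * c) * (hom x y / dhom x y)"
    unfolding val_def using nz by (simp add: divide_simps) algebra
  ultimately show ?thesis by simp
qed

lemma DERIV_val_ge:
  assumes xy: "0 \<le> x" "x \<le> y" and k: "0 \<le> k"
    and le: "p * q * val x y - (s - r) * c \<le> k * (c * p)"
  shows "(1 - k) * c \<le> c - (p * q * val x y - (s - r) * c) * (hom x y / dhom x y)"
proof -
  have d: "0 < dhom x y" and h: "0 \<le> hom x y" using xy by (auto intro: dhom_pos hom_nonneg)
  have "(p * q * val x y - (s - r) * c) * (hom x y / dhom x y) \<le> k * (c * p) * (hom x y / dhom x y)"
    using le d h by (intro mult_right_mono) auto
  also have "\<dots> = k * c * (p * hom x y / dhom x y)" by simp
  also have "\<dots> \<le> k * c * 1"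
    using k pos d hom_growth[OF xy] by (intro mult_left_mono) auto
  finally show ?thesis by (simp add: algebra_simps)
qed

lemma continuous_on_val: "continuous_on {(x, y). 0 \<le> x \<and> x \<le> y} (\<lambda>(x, y). val x y)"
proof -
  have "continuous_on {(x, y). 0 \<le> x \<and> x \<le> y} (\<lambda>z. val (fst z) (snd z))"
    unfolding val_def hom_def wr_def
    by (intro continuous_intros) (auto simp: dhom_def intro!: continuous_intros dest: dhom_pos)
  then show ?thesis by (simp add: case_prod_unfold)
qed

lemma continuous_on_slope: "continuous_on {(x, y). 0 \<le> x \<and> x \<le> y} (\<lambda>(x, y). slope x y)"
proof -
  have "continuous_on {(x, y). 0 \<le> x \<and> x \<le> y} (\<lambda>z. slope (fst z) (snd z))"
    unfolding slope_def dpart_def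
    by (intro continuous_intros) (auto simp: dhom_def intro!: continuous_intros dest: dhom_pos)
  then show ?thesis by (simp add: case_prod_unfold)
qed

lemma slope_diagonal: "0 \<le> x \<Longrightarrow> slope x x = c"
  using pos dphi_pos[of p q x] by (simp add: slope_def dpart_def dhom_def)

lemma slope_0: "slope 0 y = c / dphi r s y"
  using pos by (simp add: slope_def dpart_def dhom_def)

lemma val_0: "val 0 y = c * phi r s y / dphi r s y"
  using pos by (simp add: val_def wr_def hom_def dhom_def)

lemma curvature_0:
  "p * q * val 0 y - (s - r) * c
    = c / (r * exp (r * y) + s * exp (- s * y)) * (r\<^sup>2 * exp (r * y) - s\<^sup>2 * exp (- s * y))"
proof -
  have d: "r * exp (r * y) + s * exp (- s * y) > 0" using pos by (intro add_pos_pos) auto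
  show ?thesis
    unfolding val_0 prod_eq phi_def dphi_def using pos d
    by (simp add: divide_simps) algebra
qed

text \<open>For \<open>x = y\<close> large, \<open>p * q * val x x\<close> is at least about \<open>c * q - m\<close>, and \<open>c * q - m > (s - r) * c\<close>
  is the lower bound on \<open>c\<close> in another form.\<close>

lemma val_diagonal_eventually:
  assumes "m < c * (p + m)"
  shows "\<forall>\<^sub>F x in at_top. (s - r) * c < p * q * val x x"
proof -
  have "((\<lambda>x. p * q * (c * (phi p q x / dphi p q x)) - m) \<longlongrightarrow> p * q * (c * (1 / p)) - m) at_top"
    using pos by (intro tendsto_intros tendsto_phi_over_dphi) auto
  moreover have "(s - r) * c < p * q * (c * (1 / p)) - m"
    using assms pos by (simp add: m_def algebra_simps)
  ultimately have "\<forall>\<^sub>F x in at_top. (s - r) * c < p * q * (c * (phi p q x / dphi p q x)) - m"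
    by (rule order_tendstoD)
  then show ?thesis
  proof eventually_elim
    case (elim x)
    have d: "dphi p q x > 0" using pos by (intro dphi_pos) auto
    have "p * q * val x x = p * q * (c * (phi p q x / dphi p q x)) - m + m * exp ((p - q) * x) / dphi p q x"
      using pos d by (simp add: val_def hom_def dhom_def wr_def field_simps)
    moreover have "0 \<le> m * exp ((p - q) * x) / dphi p q x" using d m_pos by simp
    ultimately show ?case using elim by linarith
  qed
qed

text \<open>The linear system for the five coefficients, in terms of the exponents only.\<close>

definition coeffs :: "real \<Rightarrow> real \<Rightarrow> (nat \<Rightarrow> real) \<Rightarrow> bool" where
  "coeffs x y a \<longleftrightarrow>
      m / (p * q) + a 1 + a 2 = 0 \<and>
      m / (p * q) + a 1 * exp (p * x) + a 2 * exp (- q * x) = a 3 * exp (r * x) + a 4 * exp (- s * x) \<and>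
      a 1 * p * exp (p * x) - a 2 * q * exp (- q * x) = a 3 * r * exp (r * x) - a 4 * s * exp (- s * x) \<and>
      a 3 * exp (r * y) + a 4 * exp (- s * y) = - c * y + a 5 \<and>
      a 3 * r * exp (r * y) - a 4 * s * exp (- s * y) = - c"

text \<open>The first equation of the system leaves one free parameter below \<open>x\<close>, the coefficient \<open>b\<close> of \<open>hom\<close>.
  The two matching conditions carry it across \<open>x\<close>, and the slope condition at \<open>y\<close> determines it because
  \<open>dhom x y\<close> is positive. The minus signs appear since the system describes \<open>- f\<close>.\<close>

lemma coeffs_solution:
  fixes a :: "nat \<Rightarrow> real"
  assumes xy: "0 \<le> x" "x \<le> y" and a: "coeffs x y a"
  defines "b \<equiv> - (p + q) * a 1 - m / p"
  shows "b = (c - dpart x y) / dhom x y"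
    and "a 1 * p * exp (p * x) - a 2 * q * exp (- q * x) = - slope x y"
    and "a 3 * exp (r * y) + a 4 * exp (- s * y) = - val x y"
proof -
  have nz: "p + q \<noteq> 0" "r + s \<noteq> 0" "p \<noteq> 0" "q \<noteq> 0" using pos by auto
  define k where "k = m / (p * q)"
  have mk: "m = k * (p * q)" and mp: "m / p = k * q" using nz by (simp_all add: k_def)
  have a1: "a 1 = - (b + k * q) / (p + q)" using nz by (simp add: b_def mp divide_simps) algebra
  have a2: "a 2 = - k - a 1" using a by (simp add: coeffs_def k_def)
  define u where "u = a 3 * exp (r * x) + a 4 * exp (- s * x)"
  define v where "v = a 3 * r * exp (r * x) - a 4 * s * exp (- s * x)"
  have u: "u = - (k * (dphi p q x + (q - p) * phi p q x - 1) + b * phi p q x)"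
  proof -
    have "u = k + a 1 * exp (p * x) + a 2 * exp (- q * x)"
      using a by (simp add: coeffs_def k_def u_def)
    also have "\<dots> = - (k * (dphi p q x + (q - p) * phi p q x - 1) + b * phi p q x)"
      unfolding a2 a1 phi_def dphi_def using nz by (simp add: divide_simps) algebra
    finally show ?thesis .
  qed
  have v': "v = a 1 * p * exp (p * x) - a 2 * q * exp (- q * x)"
    using a by (simp add: coeffs_def v_def)
  also have "\<dots> = - (m * phi p q x + b * dphi p q x)"
    unfolding a2 a1 phi_def dphi_def mk using nz by (simp add: divide_simps) algebra
  finally have v: "v = - (m * phi p q x + b * dphi p q x)" .
  note eqs = exponentials_from_initial_data[OF nz(2) u_def v_def, of y]
  have d: "dhom x y > 0" using xy by (rule dhom_pos)
  have "- c = - (dpart x y + b * dhom x y)"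
    using a unfolding coeffs_def eqs(2) u v dpart_def dhom_def k_def by argo
  then show b: "b = (c - dpart x y) / dhom x y"
    using d by (simp add: field_simps)
  then show "a 1 * p * exp (p * x) - a 2 * q * exp (- q * x) = - slope x y"
    using v v' by (simp add: slope_def mult.commute)
  have "val x y = part x y + b * hom x y"
    unfolding val_def b wr_eq[symmetric] using d by (simp add: field_simps)
  then show "a 3 * exp (r * y) + a 4 * exp (- s * y) = - val x y"
    unfolding eqs(1) u v part_def hom_def k_def by argo
qed

lemma coeffs_curvature:
  assumes "0 \<le> x" "x \<le> y" and a: "coeffs x y a"
  shows "a 3 * r\<^sup>2 * exp (r * y) + a 4 * s\<^sup>2 * exp (- s * y) = - (p * q * val x y - (s - r) * c)"
proof -
  have "a 3 * r * exp (r * y) - a 4 * s * exp (- s * y) = - c" using a by (simp add: coeffs_def)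
  with coeffs_solution(3)[OF assms] show ?thesis unfolding prod_eq by algebra
qed

lemma coeffs_unique:
  assumes xy: "0 \<le> x" "x \<le> y" and "coeffs x y a" "coeffs x y b" and "i \<in> {1..5}"
  shows "a i = b i"
proof -
  have "- (p + q) * a 1 - m / p = - (p + q) * b 1 - m / p"
    using coeffs_solution(1) assms by metis
  then have 1: "a 1 = b 1" using pos by simp
  then have 2: "a 2 = b 2" using assms by (simp add: coeffs_def)
  define A B where "A = exp (r * x)" and "B = exp (- s * x)"
  have AB: "A > 0" "B > 0" by (simp_all add: A_def B_def)
  have e: "a 3 * A + a 4 * B = b 3 * A + b 4 * B" 
    "a 3 * r * A - a 4 * s * B = b 3 * r * A - b 4 * s * B"
    using assms(3,4) 1 2 unfolding coeffs_def A_def B_def by metis+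
  then have "(r + s) * A * a 3 = (r + s) * A * b 3" "(r + s) * B * a 4 = (r + s) * B * b 4" by algebra+
  then have 34: "a 3 = b 3" "a 4 = b 4" using pos AB by simp_all
  then have 5: "a 5 = b 5" using assms by (simp add: coeffs_def)
  have "i = 1 \<or> i = 2 \<or> i = 3 \<or> i = 4 \<or> i = 5" using assms(5) by auto
  with 1 2 34 5 show ?thesis by auto
qed

lemma coeffs_exist:
  assumes xy: "0 \<le> x" "x \<le> y"
  shows "\<exists>a \<in> extensional {1..5}. coeffs x y a"
proof -
  have nz: "p + q \<noteq> 0" "r + s \<noteq> 0" "p \<noteq> 0" "q \<noteq> 0" using pos by auto
  define b where "b = (c - dpart x y) / dhom x y"
  define k where "k = m / (p * q)"
  have mk: "m = k * (p * q)" using nz by (simp_all add: k_def)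
  define a1 where "a1 = - (b + k * q) / (p + q)"
  define a2 where "a2 = - k - a1"
  define u where "u = k + a1 * exp (p * x) + a2 * exp (- q * x)"
  define v where "v = a1 * p * exp (p * x) - a2 * q * exp (- q * x)"
  define a3 where "a3 = (s * u + v) / ((r + s) * exp (r * x))"
  define a4 where "a4 = (r * u - v) / ((r + s) * exp (- s * x))"
  have 3: "a3 * exp (r * x) = (s * u + v) / (r + s)" by (simp add: a3_def)
  have 4: "a4 * exp (- s * x) = (r * u - v) / (r + s)" by (simp add: a4_def)
  have u': "u = a3 * exp (r * x) + a4 * exp (- s * x)"
    unfolding 3 4 using nz by (simp add: divide_simps) algebra
  have v': "v = a3 * r * exp (r * x) - a4 * s * exp (- s * x)"
  proof -
    have "a3 * r * exp (r * x) - a4 * s * exp (- s * x)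
      = r * ((s * u + v) / (r + s)) - s * ((r * u - v) / (r + s))"
      unfolding 3[symmetric] 4[symmetric] by algebra
    also have "\<dots> = v" using nz by (simp add: divide_simps) algebra
    finally show ?thesis by simp
  qed
  have u: "u = - (k * (dphi p q x + (q - p) * phi p q x - 1) + b * phi p q x)"
    unfolding u_def a2_def a1_def phi_def dphi_def using nz
    by (simp add: divide_simps) algebra
  have v: "v = - (m * phi p q x + b * dphi p q x)"
    unfolding v_def a2_def a1_def phi_def dphi_def mk using nz
    by (simp add: divide_simps) algebra
  have d: "dhom x y > 0" using xy by (rule dhom_pos)
  have "a3 * r * exp (r * y) - a4 * s * exp (- s * y) = - (dpart x y + b * dhom x y)"
    unfolding exponentials_from_initial_data(2)[OF nz(2) u' v', of y] u v dpart_def dhom_def k_def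
    by argo
  also have "\<dots> = - c" using d by (simp add: b_def)
  finally have 5: "a3 * r * exp (r * y) - a4 * s * exp (- s * y) = - c" .
  define a :: "nat \<Rightarrow> real" where
    "a = (\<lambda>_. undefined)(1 := a1, 2 := a2, 3 := a3, 4 := a4,
        5 := a3 * exp (r * y) + a4 * exp (- s * y) + c * y)"
  have "a \<in> extensional {1..5}" by (auto simp: a_def extensional_def)
  moreover have "coeffs x y a"
    unfolding coeffs_def using 5 u' v' by (simp add: a_def a2_def u_def v_def k_def)
  ultimately show ?thesis by blast
qed

end

section \<open>A sign-change curve in a wedge\<close>

lemma positive_after_nonneg:
  fixes f f' :: "real \<Rightarrow> real"
  assumes deriv: "\<And>y. a \<le> y \<Longrightarrow> (f has_real_derivative f' y) (at y)"
    and up: "\<And>y. a \<le> y \<Longrightarrow> f y = 0 \<Longrightarrow> 0 < f' y"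
    and "a \<le> u" "u < v" "0 \<le> f u"
  shows "0 < f v"
proof (rule ccontr)
  assume neg: "\<not> 0 < f v"
  have "\<exists>u'. u \<le> u' \<and> u' < v \<and> 0 < f u'"
  proof (cases "f u = 0")
    case True
    with assms obtain d where "d > 0" and d: "\<And>h. 0 < h \<Longrightarrow> h < d \<Longrightarrow> f u < f (u + h)"
      using DERIV_pos_inc_right[OF deriv up] by metis
    define h where "h = min (d / 2) ((v - u) / 2)"
    have "0 < h" "h < d" "u + h < v" using \<open>d > 0\<close> \<open>u < v\<close> by (auto simp: h_def min_def field_simps)
    with d[of h] True show ?thesis by (intro exI[of _ "u + h"]) auto
  next
    case False
    with assms show ?thesis by (intro exI[of _ u]) auto
  qed
  then obtain u' where u': "u \<le> u'" "u' < v" "0 < f u'" by blast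
  have cont: "continuous_on {u'..v} f"
    using assms u' by (intro continuous_at_imp_continuous_on) (auto intro!: DERIV_isCont deriv)
  \<comment> \<open>at its first zero after \<open>u'\<close>, the function would come down from positive values\<close>
  define Z where "Z = {z \<in> {u'..v}. f z = 0}"
  have "closed Z" unfolding Z_def
    using continuous_closed_preimage[OF cont closed_atLeastAtMost closed_singleton[of 0]]
    by (simp add: vimage_def Int_def)
  moreover have "Z \<noteq> {}" "bdd_below Z"
    using IVT2'[of f v 0 u'] neg u' cont by (auto simp: Z_def)
  ultimately have "Inf Z \<in> Z" by (rule closed_contains_Inf[rotated 2]) 
  define z where "z = Inf Z"
  have z: "u' \<le> z" "z \<le> v" "f z = 0" using \<open>Inf Z \<in> Z\<close> by (auto simp: z_def Z_def)
  then have "u' < z" using u' by (cases "u' = z") auto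
  have "0 < f' z" using z u' assms by (intro up) auto
  moreover have "(f has_real_derivative f' z) (at z)" using z u' assms by (intro deriv) auto
  ultimately obtain d where "d > 0" and d: "\<And>h. 0 < h \<Longrightarrow> h < d \<Longrightarrow> f (z - h) < f z"
    using DERIV_pos_inc_left by metis
  define h where "h = min (d / 2) ((z - u') / 2)"
  have h: "0 < h" "h < d" "u' < z - h"
    using \<open>d > 0\<close> \<open>u' < z\<close> by (auto simp: h_def min_def field_simps)
  then have "f (z - h) \<le> 0" using d[of h] z by simp
  then obtain z' where "u' \<le> z'" "z' \<le> z - h" "f z' = 0"
    using IVT2'[of f "z - h" 0 u'] u' h z cont continuous_on_subset[OF cont, of "{u'..z - h}"] by auto
  then have "z' \<in> Z" using h z by (auto simp: Z_def)
  then have "z \<le> z'" unfolding z_def using \<open>bdd_below Z\<close> by (rule cInf_lower)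
  with \<open>z' \<le> z - h\<close> \<open>0 < h\<close> show False by simp
qed

text \<open>A rate of growth at least \<open>e\<close> while nonpositive forces a zero within distance \<open>- f a / e\<close> of \<open>a\<close>,
  without any information on the limit at infinity. The point \<open>z\<close> is \<open>a\<close> itself if \<open>f a \<ge> 0\<close>.\<close>

lemma threshold_exists:
  fixes f f' :: "real \<Rightarrow> real"
  assumes deriv: "\<And>y. a \<le> y \<Longrightarrow> (f has_real_derivative f' y) (at y)"
    and up: "\<And>y. a \<le> y \<Longrightarrow> f y \<le> 0 \<Longrightarrow> e \<le> f' y" and "0 < e"
  shows "\<exists>z\<ge>a. (\<forall>y. a \<le> y \<longrightarrow> y < z \<longrightarrow> f y < 0) \<and> (\<forall>y>z. 0 < f y) \<and> (a < z \<longrightarrow> f z = 0)"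
proof -
  have after: "0 < f v" if "a \<le> u" "u < v" "0 \<le> f u" for u v
    using positive_after_nonneg[OF deriv _ that] up \<open>0 < e\<close> by (smt (verit))
  have cont: "continuous_on {a..b} f" for b
    by (intro continuous_at_imp_continuous_on) (auto intro!: DERIV_isCont deriv)
  show ?thesis
  proof (cases "0 \<le> f a")
    case True
    then show ?thesis using after by (intro exI[of _ a]) auto
  next
    case False
    have "\<exists>b\<ge>a. 0 \<le> f b"
    proof (rule ccontr)
      assume "\<not> ?thesis"
      then have neg: "\<And>y. a \<le> y \<Longrightarrow> f y < 0" by force
      define b where "b = a - f a / e"
      have "a < b" using False \<open>0 < e\<close> by (simp add: b_def divide_neg_pos)
      then obtain y where y: "a < y" "y < b" "f b - f a = (b - a) * f' y"
        using MVT2[of a b f f'] deriv by auto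
      have "(b - a) * e \<le> (b - a) * f' y"
        using y neg[of y] up[of y] by (intro mult_left_mono) auto
      moreover have "(b - a) * e = - f a" using \<open>0 < e\<close> by (simp add: b_def)
      ultimately show False using y(3) neg[of b] \<open>a < b\<close> by linarith
    qed
    then obtain b where "a \<le> b" "0 \<le> f b" by blast
    then obtain z where z: "a \<le> z" "f z = 0"
      using IVT'[of f a 0 b] False cont by auto
    then show ?thesis using after by (intro exI[of _ z]) (force simp: not_less)
  qed
qed

text \<open>The sign-change point \<open>X x\<close> of \<open>G x\<close> depends continuously on \<open>x\<close>, because the signs of \<open>G\<close> slightly
  above and slightly below \<open>X x\<close> persist under small changes of \<open>x\<close>. It is defined for all \<open>x \<ge> 0\<close>, also where
  \<open>G x x\<close> is already positive; there the curve runs along the diagonal, where \<open>S < l\<close>. Hence a point of the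
  curve with \<open>S = l\<close> lies off the diagonal and is a zero of \<open>G\<close>.\<close>

lemma wedge_crossing:
  fixes G G' S :: "real \<Rightarrow> real \<Rightarrow> real"
  assumes contG: "continuous_on {(x, y). 0 \<le> x \<and> x \<le> y} (\<lambda>(x, y). G x y)"
    and contS: "continuous_on {(x, y). 0 \<le> x \<and> x \<le> y} (\<lambda>(x, y). S x y)"
    and deriv: "\<And>x y. 0 \<le> x \<Longrightarrow> x \<le> y \<Longrightarrow> (G x has_real_derivative G' x y) (at y)"
    and up: "\<And>x y. 0 \<le> x \<Longrightarrow> x \<le> y \<Longrightarrow> G x y \<le> 0 \<Longrightarrow> e \<le> G' x y" and "0 < e"
    and start: "0 < z" "G 0 z = 0" "l < S 0 z"
    and stop: "0 \<le> b" "0 \<le> G b b"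
    and diag: "\<And>x. 0 \<le> x \<Longrightarrow> S x x < l"
  shows "\<exists>x y. 0 < x \<and> x < y \<and> G x y = 0 \<and> S x y = l"
proof -
  have "\<forall>x\<in>{0..}. \<exists>z\<ge>x. (\<forall>y. x \<le> y \<longrightarrow> y < z \<longrightarrow> G x y < 0) \<and> (\<forall>y>z. 0 < G x y) \<and> (x < z \<longrightarrow> G x z = 0)"
    using deriv up \<open>0 < e\<close> by (intro ballI threshold_exists) auto
  from bchoice[OF this] obtain X where X: "\<forall>x\<in>{0..}. x \<le> X x
      \<and> (\<forall>y. x \<le> y \<longrightarrow> y < X x \<longrightarrow> G x y < 0) \<and> (\<forall>y>X x. 0 < G x y) \<and> (x < X x \<longrightarrow> G x (X x) = 0)" ..
  then have ge: "\<And>x. 0 \<le> x \<Longrightarrow> x \<le> X x"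
    and below: "\<And>x y. 0 \<le> x \<Longrightarrow> x \<le> y \<Longrightarrow> y < X x \<Longrightarrow> G x y < 0"
    and above: "\<And>x y. 0 \<le> x \<Longrightarrow> X x < y \<Longrightarrow> 0 < G x y"
    and zero: "\<And>x. 0 \<le> x \<Longrightarrow> x < X x \<Longrightarrow> G x (X x) = 0"
    by auto
  have X0: "X 0 = z" using below[of 0 z] above[of 0 z] start by force
  have Xb: "X b = b" using below[of b b] ge[of b] stop by force
  have contGx: "continuous_on {0..y} (\<lambda>x. G x y)" for y
  proof -
    have "continuous_on {0..y} (\<lambda>x. case (x, y) of (x, y) \<Rightarrow> G x y)"
      by (rule continuous_on_compose2[OF contG]) (auto intro!: continuous_intros)
    then show ?thesis by simp
  qed
  have contX: "continuous_on {0..b} X"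
    unfolding continuous_on_iff
  proof (intro ballI allI impI)
    fix x \<epsilon> :: real
    assume x: "x \<in> {0..b}" and "0 < \<epsilon>"
    define y where "y = X x + \<epsilon> / 2"
    have y: "x < y" using ge[of x] x \<open>0 < \<epsilon>\<close> by (auto simp: y_def)
    have "0 < G x y" using above[of x y] x \<open>0 < \<epsilon>\<close> by (simp add: y_def)
    then obtain d1 where d1: "d1 > 0" "\<And>x'. x' \<in> {0..y} \<Longrightarrow> dist x' x < d1 \<Longrightarrow> 0 < G x' y"
      using contGx[of y, unfolded continuous_on_iff, rule_format, of x "G x y"] x y
      by (auto simp: dist_real_def abs_less_iff)
    have upper: "X x' \<le> y" if "x' \<in> {0..b}" "dist x' x < d1" "dist x' x < y - x" for x'
    proof (rule ccontr)
      assume "\<not> X x' \<le> y"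
      then have "G x' y < 0" using that by (intro below) (auto simp: dist_real_def)
      moreover have "0 < G x' y" using that d1 by (auto simp: dist_real_def)
      ultimately show False by simp
    qed
    show "\<exists>d>0. \<forall>x'\<in>{0..b}. dist x' x < d \<longrightarrow> dist (X x') (X x) < \<epsilon>"
    proof (cases "X x = x")
      case True
      have "dist (X x') (X x) < \<epsilon>" if "x' \<in> {0..b}" "dist x' x < min (min d1 (y - x)) \<epsilon>" for x'
      proof -
        have "X x' \<le> y" "x' \<le> X x'" using upper[of x'] ge[of x'] that by auto
        moreover have "x - \<epsilon> < x'" using that by (auto simp: dist_real_def)
        ultimately show ?thesis using True \<open>0 < \<epsilon>\<close> by (simp add: dist_real_def y_def)
      qed
      then show ?thesis using d1 y \<open>0 < \<epsilon>\<close> by (intro exI[of _ "min (min d1 (y - x)) \<epsilon>"]) auto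
    next
      case False
      with ge[of x] x have "x < X x" by force
      \<comment> \<open>a level within \<open>\<epsilon>\<close> below \<open>X x\<close> that is still above the diagonal\<close>
      define w where "w = max (X x - \<epsilon> / 2) ((x + X x) / 2)"
      have w: "x < w" "w < X x" "X x - \<epsilon> / 2 \<le> w"
        using \<open>x < X x\<close> \<open>0 < \<epsilon>\<close> by (auto simp: w_def max_def field_simps)
      have "G x w < 0" using below[of x w] x w by auto
      then obtain d2 where d2: "d2 > 0" "\<And>x'. x' \<in> {0..w} \<Longrightarrow> dist x' x < d2 \<Longrightarrow> G x' w < 0"
        using contGx[of w, unfolded continuous_on_iff, rule_format, of x "- G x w"] x w
        by (auto simp: dist_real_def abs_less_iff)
      have lower: "w \<le> X x'" if "x' \<in> {0..b}" "dist x' x < d2" "dist x' x < w - x" for x'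
      proof (rule ccontr)
        assume "\<not> w \<le> X x'"
        then have "0 < G x' w" using that by (intro above) (auto simp: dist_real_def)
        moreover have "G x' w < 0" using that d2 by (auto simp: dist_real_def)
        ultimately show False by simp
      qed
      have "dist (X x') (X x) < \<epsilon>"
        if "x' \<in> {0..b}" "dist x' x < min (min d1 (y - x)) (min d2 (w - x))" for x'
        using upper[of x'] lower[of x'] that w \<open>0 < \<epsilon>\<close> by (auto simp: dist_real_def y_def)
      then show ?thesis using d1 d2 y w
        by (intro exI[of _ "min (min d1 (y - x)) (min d2 (w - x))"]) auto
    qed
  qed
  have "continuous_on {0..b} (\<lambda>x. case (x, X x) of (x, y) \<Rightarrow> S x y)"
    by (rule continuous_on_compose2[OF contS]) (auto intro!: continuous_intros contX ge)
  then have "continuous_on {0..b} (\<lambda>x. S x (X x))" by simp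
  moreover have "S b (X b) < l" using Xb diag stop by simp
  ultimately obtain x where x: "0 \<le> x" "x \<le> b" "S x (X x) = l"
    using IVT2'[of "\<lambda>x. S x (X x)" b l 0] X0 start stop by auto
  have "x < X x" using ge[of x] diag[of x] x by (cases "X x = x") auto
  moreover have "x \<noteq> 0" using x X0 start by auto
  ultimately show ?thesis using x zero[of x] by (intro exI[of _ x] exI[of _ "X x"]) auto
qed


section \<open>Two discount rates\<close>

locale two_discounts =
  D1: two_drifts p1 q1 r1 s1 c + D2: two_drifts p2 q2 r2 s2 c
  for p1 q1 r1 s1 p2 q2 r2 s2 c :: real +
  fixes w1 w2 n :: real
  assumes weights: "0 < w1" "0 < w2" "w1 + w2 = 1"
    and common: "s1 - r1 = n" "s2 - r2 = n"
    and balance: "n * w2 < w1 * p1" "n * w1 < w2 * p2"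
    and cost: "D1.m < c * (p1 + D1.m)" "D2.m < c * (p2 + D2.m)" "c < 1"
begin

definition curv :: "real \<Rightarrow> real \<Rightarrow> real" where
  "curv x y = w1 * (p1 * q1 * D1.val x y - n * c) + w2 * (p2 * q2 * D2.val x y - n * c)"

definition dcurv :: "real \<Rightarrow> real \<Rightarrow> real" where
  "dcurv x y = w1 * (p1 * q1 * (c - (p1 * q1 * D1.val x y - n * c) * (D1.hom x y / D1.dhom x y)))
     + w2 * (p2 * q2 * (c - (p2 * q2 * D2.val x y - n * c) * (D2.hom x y / D2.dhom x y)))"

definition mean_slope :: "real \<Rightarrow> real \<Rightarrow> real" where
  "mean_slope x y = w1 * D1.slope x y + w2 * D2.slope x y"

text \<open>The rate of growth obtained from \<open>DERIV_val_ge\<close> when \<open>k\<close> is taken as \<open>n * w2 / (w1 * p1)\<close> and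
  \<open>n * w1 / (w2 * p2)\<close>, which are below \<open>1\<close> by the two balance conditions.\<close>

definition gap :: real where
  "gap = w1 * (p1 * q1 * ((1 - n * w2 / (w1 * p1)) * c)) + w2 * (p2 * q2 * ((1 - n * w1 / (w2 * p2)) * c))"

lemma n_pos: "0 < n"
  using common D1.drift by simp

lemma gap_pos: "0 < gap"
  unfolding gap_def using weights balance D1.pos D2.pos
  by (intro add_pos_pos mult_pos_pos) auto

lemma DERIV_curv:
  assumes "0 \<le> x" "x \<le> y"
  shows "(curv x has_real_derivative dcurv x y) (at y)"
  unfolding curv_def dcurv_def
  using D1.DERIV_val[OF assms] D2.DERIV_val[OF assms] unfolding common
  by (auto intro!: derivative_eq_intros simp: algebra_simps)

text \<open>As the values are nonnegative, each second derivative at \<open>y\<close> is at least \<open>- n * c\<close>. If their weighted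
  mean is at most \<open>0\<close>, the other one is therefore at most \<open>n * c\<close> times the ratio of the weights.\<close>

lemma dcurv_ge_gap:
  assumes xy: "0 \<le> x" "x \<le> y" and le: "curv x y \<le> 0"
  shows "gap \<le> dcurv x y"
proof -
  have nn: "0 \<le> w1 * (p1 * q1 * D1.val x y)" "0 \<le> w2 * (p2 * q2 * D2.val x y)"
    using D1.val_nonneg[OF cost(1) xy] D2.val_nonneg[OF cost(2) xy] weights D1.pos D2.pos by auto
  have "w1 * (p1 * q1 * D1.val x y - n * c) \<le> w2 * (n * c)"
    using le nn unfolding curv_def by (simp add: algebra_simps)
  then have b1: "p1 * q1 * D1.val x y - n * c \<le> n * w2 / (w1 * p1) * (c * p1)"
    using weights D1.pos by (simp add: field_simps)
  have "w2 * (p2 * q2 * D2.val x y - n * c) \<le> w1 * (n * c)"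
    using le nn unfolding curv_def by (simp add: algebra_simps)
  then have b2: "p2 * q2 * D2.val x y - n * c \<le> n * w1 / (w2 * p2) * (c * p2)"
    using weights D2.pos by (simp add: field_simps)
  show ?thesis
    unfolding gap_def dcurv_def
    using weights n_pos D1.pos D2.pos b1 b2
      D1.DERIV_val_ge[OF xy, of "n * w2 / (w1 * p1)", unfolded common]
      D2.DERIV_val_ge[OF xy, of "n * w1 / (w2 * p2)", unfolded common]
    by (intro add_mono mult_left_mono) auto
qed

lemma continuous_on_curv: "continuous_on {(x, y). 0 \<le> x \<and> x \<le> y} (\<lambda>(x, y). curv x y)"
  using D1.continuous_on_val D2.continuous_on_val
  unfolding curv_def case_prod_unfold by (intro continuous_intros)

lemma continuous_on_mean_slope:
  "continuous_on {(x, y). 0 \<le> x \<and> x \<le> y} (\<lambda>(x, y). mean_slope x y)"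
  using D1.continuous_on_slope D2.continuous_on_slope
  unfolding mean_slope_def case_prod_unfold by (intro continuous_intros)

lemma curv_00: "curv 0 0 < 0"
proof -
  have "curv 0 0 = - (w1 + w2) * (n * c)"
    unfolding curv_def D1.val_0 D2.val_0 by (simp add: algebra_simps)
  then show ?thesis using weights n_pos D1.pos by simp
qed

lemma ex1_curv_0: "\<exists>!z. 0 < z \<and> curv 0 z = 0"
proof -
  obtain z where z: "0 \<le> z" "\<And>y. 0 \<le> y \<Longrightarrow> y < z \<Longrightarrow> curv 0 y < 0" "\<And>y. z < y \<Longrightarrow> 0 < curv 0 y"
      "0 < z \<Longrightarrow> curv 0 z = 0"
    using threshold_exists[of 0 "curv 0" "dcurv 0" gap] DERIV_curv dcurv_ge_gap gap_pos by auto
  have "0 < z"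
  proof (rule ccontr)
    assume "\<not> 0 < z"
    with z have pos: "0 < curv 0 y" if "0 < y" for y using that by auto
    obtain d where "d > 0" and d: "\<And>y. 0 \<le> y \<Longrightarrow> y < d \<Longrightarrow> curv 0 y < 0"
    proof -
      have "isCont (curv 0) 0" using DERIV_curv[of 0 0] by (auto intro: DERIV_isCont)
      then have "\<forall>\<^sub>F y in at 0. curv 0 y < 0"
        using curv_00 unfolding isCont_def by (rule order_tendstoD)
      then obtain d where "d > 0" "\<And>y. y \<noteq> 0 \<Longrightarrow> dist y 0 < d \<Longrightarrow> curv 0 y < 0"
        unfolding eventually_at by auto
      with curv_00 that[of d] show thesis by (metis abs_of_nonneg dist_0_norm dist_commute real_norm_def)
    qed
    have "curv 0 (d / 2) < 0" "0 < curv 0 (d / 2)"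
      using \<open>d > 0\<close> by (auto intro!: d pos)
    then show False by simp
  qed
  with z show ?thesis by (metis less_imp_le linorder_neqE_linordered_idom less_irrefl)
qed

lemma curv_diagonal_nonneg: "\<exists>b\<ge>0. 0 \<le> curv b b"
proof -
  have "\<forall>\<^sub>F x in at_top. 0 \<le> x \<and> 0 \<le> curv x x"
    using D1.val_diagonal_eventually[OF cost(1)] D2.val_diagonal_eventually[OF cost(2)]
      eventually_ge_at_top[of "0::real"]
  proof eventually_elim
    case (elim x)
    then show ?case using weights common by (auto simp: curv_def intro!: add_nonneg_nonneg)
  qed
  then show ?thesis using eventually_happens[of _ "at_top :: real filter"] by auto
qed

lemma mean_slope_diagonal: "0 \<le> x \<Longrightarrow> mean_slope x x = c"
  using weights unfolding mean_slope_def
  by (simp add: D1.slope_diagonal D2.slope_diagonal flip: distrib_right)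

lemma solution_exists:
  assumes "0 < z" "curv 0 z = 0" "1 < mean_slope 0 z"
  shows "\<exists>x y. 0 < x \<and> x < y \<and> curv x y = 0 \<and> mean_slope x y = 1"
proof -
  obtain b where "0 \<le> b" "0 \<le> curv b b" using curv_diagonal_nonneg by blast
  then show ?thesis
    using assms continuous_on_curv continuous_on_mean_slope DERIV_curv dcurv_ge_gap gap_pos
      mean_slope_diagonal cost(3)
    by (intro wedge_crossing[of curv mean_slope dcurv gap z 1 b]) auto
qed

end

section \<open>The exponents \<open>\<theta>\<close> and the coefficients \<open>A\<close>\<close>

lemma quadratic_roots:
  fixes b d \<sigma> :: real
  assumes "0 < b" "0 < d" "0 < \<sigma>"
  defines "R \<equiv> sqrt (b\<^sup>2 + 2 * d * \<sigma>\<^sup>2)"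
  shows "0 < (- b + R) / \<sigma>\<^sup>2" and "(- b + R) / \<sigma>\<^sup>2 * ((b + R) / \<sigma>\<^sup>2) = 2 * d / \<sigma>\<^sup>2"
    and "(b + R) / \<sigma>\<^sup>2 - (- b + R) / \<sigma>\<^sup>2 = 2 * b / \<sigma>\<^sup>2"
proof -
  have "sqrt (b\<^sup>2) < R" unfolding R_def using assms by (intro real_sqrt_less_mono) simp
  then show "0 < (- b + R) / \<sigma>\<^sup>2" using assms by simp
  have "R\<^sup>2 = b\<^sup>2 + 2 * d * \<sigma>\<^sup>2" unfolding R_def using assms by (intro real_sqrt_pow2) simp
  then have "(- b + R) * (b + R) = 2 * d * \<sigma>\<^sup>2" by algebra
  then show "(- b + R) / \<sigma>\<^sup>2 * ((b + R) / \<sigma>\<^sup>2) = 2 * d / \<sigma>\<^sup>2"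
    using assms by (simp add: divide_simps power2_eq_square)
  show "(b + R) / \<sigma>\<^sup>2 - (- b + R) / \<sigma>\<^sup>2 = 2 * b / \<sigma>\<^sup>2"
    by (simp add: diff_divide_distrib[symmetric])
qed

lemma theta_facts:
  assumes "0 < \<mu>" "0 < \<sigma>" "0 < M" "0 < d"
  defines "t \<equiv> theta \<mu> \<sigma> M d"
  shows "0 < t 1" "t 1 * t 2 = 2 * d / \<sigma>\<^sup>2" "t 2 - t 1 = 2 * (\<mu> + M) / \<sigma>\<^sup>2"
    and "0 < t 3" "t 3 * t 4 = 2 * d / \<sigma>\<^sup>2" "t 4 - t 3 = 2 * \<mu> / \<sigma>\<^sup>2"
  using quadratic_roots[of "\<mu> + M" d \<sigma>] quadratic_roots[of \<mu> d \<sigma>] assms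
  by (simp_all add: theta_def)

lemma two_drifts_theta:
  assumes "0 < \<mu>" "0 < \<sigma>" "0 < M" "0 < d" "0 < c"
  defines "t \<equiv> theta \<mu> \<sigma> M d"
  shows "two_drifts (t 1) (t 2) (t 3) (t 4) c"
proof -
  note f = theta_facts[OF assms(1-4), folded t_def]
  have "0 < 2 * \<mu> / \<sigma>\<^sup>2" "2 * \<mu> / \<sigma>\<^sup>2 < 2 * (\<mu> + M) / \<sigma>\<^sup>2"
    using assms by (simp_all add: divide_strict_right_mono)
  with f assms(5) show ?thesis by unfold_locales linarith+
qed

lemma m_theta:
  assumes "0 < \<mu>" "0 < \<sigma>" "0 < M" "0 < d"
  defines "t \<equiv> theta \<mu> \<sigma> M d"
  shows "t 2 - t 1 - (t 4 - t 3) = 2 * M / \<sigma>\<^sup>2"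
  unfolding t_def theta_facts(3,6)[OF assms(1-4)]
  by (simp add: diff_divide_distrib[symmetric])

lemma coeffs_A_coeff:
  assumes "0 < \<mu>" "0 < \<sigma>" "0 < M" "0 < d" "0 < c" and xy: "0 \<le> x" "x \<le> y"
  defines "t \<equiv> theta \<mu> \<sigma> M d"
  shows "two_drifts.coeffs (t 1) (t 2) (t 3) (t 4) c x y (A_coeff \<mu> \<sigma> M d c x y)"
proof -
  interpret two_drifts "t 1" "t 2" "t 3" "t 4" c
    unfolding t_def by (rule two_drifts_theta) (use assms in auto)
  have "m / (t 1 * t 2) = M / d"
    unfolding m_def m_theta[OF assms(1-4), folded t_def] theta_facts(2)[OF assms(1-4), folded t_def]
    using assms by simp
  then have eq: "A_system \<mu> \<sigma> M d c x y a \<longleftrightarrow> coeffs x y a" for a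
    unfolding A_system_def Let_def t_def[symmetric] coeffs_def by simp
  have "\<exists>!a. a \<in> extensional {1..5} \<and> A_system \<mu> \<sigma> M d c x y a"
    unfolding eq
  proof (rule ex_ex1I)
    show "\<exists>a. a \<in> extensional {1..5} \<and> coeffs x y a" using coeffs_exist[OF xy] by blast
    show "a = b" if "a \<in> extensional {1..5} \<and> coeffs x y a" "b \<in> extensional {1..5} \<and> coeffs x y b" for a b
      using that coeffs_unique[OF xy] by (intro extensionalityI[of _ "{1..5}"]) blast+
  qed
  from theI'[OF this] show ?thesis unfolding A_coeff_def eq by blast
qed

lemma sum_1_2: "(\<Sum>i = 1..2. f i) = f 1 + f (2::nat)" for f :: "nat \<Rightarrow> real"
  by (simp add: numeral_2_eq_2)

theorem proposition5p7:
  fixes \<mu> \<sigma> M c x20 :: real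
    and \<omega> \<delta> :: "nat \<Rightarrow> real"
    and \<theta> :: "nat \<Rightarrow> nat \<Rightarrow> real"
    and A :: "nat \<Rightarrow> real \<Rightarrow> real \<Rightarrow> nat \<Rightarrow> real"
  defines "\<theta> \<equiv> \<lambda>i. theta \<mu> \<sigma> M (\<delta> i)"
    and "A \<equiv> \<lambda>i. A_coeff \<mu> \<sigma> M (\<delta> i) c"
    and "x20 \<equiv> x2_zero \<mu> \<sigma> M \<omega> \<delta> c"
  assumes "\<mu> > 0" and "\<sigma> > 0" and "M > 0"
    and "\<omega> 1 > 0" and "\<omega> 2 > 0" and "\<omega> 1 + \<omega> 2 = 1"
    and "0 < \<delta> 1" and "\<delta> 1 < \<delta> 2"
    and "(\<theta> 1 4 - \<theta> 1 3) / \<theta> 2 1 < \<omega> 2 / \<omega> 1"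
    and "(\<theta> 2 4 - \<theta> 2 3) / \<theta> 1 1 < \<omega> 1 / \<omega> 2"
    and "Max {2 * M / (\<sigma>\<^sup>2 * (\<theta> 1 2 + \<theta> 1 3 - \<theta> 1 4)),
              2 * M / (\<sigma>\<^sup>2 * (\<theta> 2 2 + \<theta> 2 3 - \<theta> 2 4)),
              1 / (\<Sum>i = 1..2. \<omega> i * ((\<theta> i 3 + \<theta> i 4) /
                    (\<theta> i 3 * exp (\<theta> i 3 * x20) + \<theta> i 4 * exp (- \<theta> i 4 * x20))))} < c"
    and "c < 1"
  shows "\<exists>x1 x2. 0 < x1 \<and> x1 < x2 \<and>
    (\<Sum>i = 1..2. \<omega> i *
      (A i x1 x2 1 * \<theta> i 1 * exp (\<theta> i 1 * x1) - A i x1 x2 2 * \<theta> i 2 * exp (- \<theta> i 2 * x1))) = -1 \<and>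
    (\<Sum>i = 1..2. \<omega> i *
      (A i x1 x2 3 * (\<theta> i 3)\<^sup>2 * exp (\<theta> i 3 * x2) + A i x1 x2 4 * (\<theta> i 4)\<^sup>2 * exp (- \<theta> i 4 * x2))) = 0"
proof -
  have d: "0 < \<delta> 1" "0 < \<delta> 2" using assms by auto
  have th: "theta \<mu> \<sigma> M (\<delta> i) = \<theta> i" for i by (simp add: \<theta>_def)
  note f1 = theta_facts[OF \<open>\<mu> > 0\<close> \<open>\<sigma> > 0\<close> \<open>M > 0\<close> d(1), unfolded th]
  note f2 = theta_facts[OF \<open>\<mu> > 0\<close> \<open>\<sigma> > 0\<close> \<open>M > 0\<close> d(2), unfolded th]
  note m1 = m_theta[OF \<open>\<mu> > 0\<close> \<open>\<sigma> > 0\<close> \<open>M > 0\<close> d(1), unfolded th]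
  note m2 = m_theta[OF \<open>\<mu> > 0\<close> \<open>\<sigma> > 0\<close> \<open>M > 0\<close> d(2), unfolded th]
  define k where "k = 2 * M / \<sigma>\<^sup>2"
  have "0 < k" using assms by (simp add: k_def)
  have e1: "\<theta> 1 2 + \<theta> 1 3 - \<theta> 1 4 = \<theta> 1 1 + k" using m1 by (simp add: k_def)
  have e2: "\<theta> 2 2 + \<theta> 2 3 - \<theta> 2 4 = \<theta> 2 1 + k" using m2 by (simp add: k_def)
  have bounds: "k / (\<theta> 1 1 + k) < c" "k / (\<theta> 2 1 + k) < c"
    "1 / (\<Sum>i = 1..2. \<omega> i * ((\<theta> i 3 + \<theta> i 4) /
        (\<theta> i 3 * exp (\<theta> i 3 * x20) + \<theta> i 4 * exp (- \<theta> i 4 * x20)))) < c"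
    using assms(14) unfolding e1 e2 by (simp_all add: k_def)
  have "0 < k / (\<theta> 1 1 + k)" using \<open>0 < k\<close> f1(1) by simp
  then have "0 < c" using bounds(1) by linarith
  interpret D1: two_drifts "\<theta> 1 1" "\<theta> 1 2" "\<theta> 1 3" "\<theta> 1 4" c
    using two_drifts_theta[OF \<open>\<mu> > 0\<close> \<open>\<sigma> > 0\<close> \<open>M > 0\<close> d(1) \<open>0 < c\<close>, unfolded th] .
  interpret D2: two_drifts "\<theta> 2 1" "\<theta> 2 2" "\<theta> 2 3" "\<theta> 2 4" c
    using two_drifts_theta[OF \<open>\<mu> > 0\<close> \<open>\<sigma> > 0\<close> \<open>M > 0\<close> d(2) \<open>0 < c\<close>, unfolded th] .
  have m: "D1.m = k" "D2.m = k" unfolding D1.m_def D2.m_def m1 m2 k_def by simp_all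
  have cross: "a * d < b' * b" if "a / b < b' / d" "0 < b" "0 < d" for a b b' d :: real
    using that by (simp add: field_simps)
  interpret two_discounts "\<theta> 1 1" "\<theta> 1 2" "\<theta> 1 3" "\<theta> 1 4" "\<theta> 2 1" "\<theta> 2 2" "\<theta> 2 3" "\<theta> 2 4" c
      "\<omega> 1" "\<omega> 2" "2 * \<mu> / \<sigma>\<^sup>2"
  proof
    show "2 * \<mu> / \<sigma>\<^sup>2 * \<omega> 2 < \<omega> 1 * \<theta> 1 1"
      using cross[OF assms(13)] \<open>\<omega> 2 > 0\<close> f1(1) unfolding f2(6) by simp
    show "2 * \<mu> / \<sigma>\<^sup>2 * \<omega> 1 < \<omega> 2 * \<theta> 2 1"
      using cross[OF assms(12)] \<open>\<omega> 1 > 0\<close> f2(1) unfolding f1(6) by simp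
    show "D1.m < c * (\<theta> 1 1 + D1.m)" "D2.m < c * (\<theta> 2 1 + D2.m)"
      unfolding m using bounds(1,2) f1(1) f2(1) \<open>0 < k\<close> by (simp_all add: divide_less_eq)
  qed (use assms f1 f2 in simp_all)
  \<comment> \<open>the equation defining \<open>x20\<close> is \<open>curv 0 x = 0\<close>, that is, the case where the switching point is \<open>0\<close>\<close>
  have "(\<Sum>i = 1..2. \<omega> i *
      (let t = theta \<mu> \<sigma> M (\<delta> i) in
        - (c / (t 3 * exp (t 3 * x) + t 4 * exp (- t 4 * x)))
          * ((t 3)\<^sup>2 * exp (t 3 * x) - (t 4)\<^sup>2 * exp (- t 4 * x)))) = - curv 0 x" for x
    unfolding sum_1_2 th Let_def curv_def
      D1.curvature_0[unfolded f1(6)] D2.curvature_0[unfolded f2(6)] by simp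
  then have "x20 = (THE x. 0 < x \<and> curv 0 x = 0)"
    unfolding x20_def x2_zero_def by simp
  then have x20: "0 < x20" "curv 0 x20 = 0" using theI'[OF ex1_curv_0] by simp_all
  have "1 < mean_slope 0 x20"
  proof -
    define S where "S = (\<Sum>i = 1..2. \<omega> i * ((\<theta> i 3 + \<theta> i 4) /
        (\<theta> i 3 * exp (\<theta> i 3 * x20) + \<theta> i 4 * exp (- \<theta> i 4 * x20))))"
    have eq: "mean_slope 0 x20 = c * S"
      unfolding mean_slope_def D1.slope_0 D2.slope_0 S_def sum_1_2 dphi_def
      by (simp add: algebra_simps)
    have "0 < mean_slope 0 x20"
      unfolding mean_slope_def D1.slope_0 D2.slope_0
      using weights D1.pos D2.pos by (intro add_pos_pos mult_pos_pos divide_pos_pos dphi_pos)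
    with eq \<open>0 < c\<close> have "0 < S" by (simp add: zero_less_mult_iff)
    with bounds(3)[folded S_def] show ?thesis unfolding eq by (simp add: divide_less_eq)
  qed
  from solution_exists[OF x20 this] obtain x y where
    xy: "0 < x" "x < y" and sol: "curv x y = 0" "mean_slope x y = 1" by blast
  have le: "0 \<le> x" "x \<le> y" using xy by auto
  have A: "A_coeff \<mu> \<sigma> M (\<delta> i) c = A i" for i by (simp add: A_def)
  note c1 = coeffs_A_coeff[OF \<open>\<mu> > 0\<close> \<open>\<sigma> > 0\<close> \<open>M > 0\<close> d(1) \<open>0 < c\<close> le, unfolded th A]
  note c2 = coeffs_A_coeff[OF \<open>\<mu> > 0\<close> \<open>\<sigma> > 0\<close> \<open>M > 0\<close> d(2) \<open>0 < c\<close> le, unfolded th A]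
  show ?thesis
  proof (intro exI conjI)
    show "0 < x" "x < y" by fact+
    show "(\<Sum>i = 1..2. \<omega> i *
      (A i x y 1 * \<theta> i 1 * exp (\<theta> i 1 * x) - A i x y 2 * \<theta> i 2 * exp (- \<theta> i 2 * x))) = -1"
      unfolding sum_1_2 D1.coeffs_solution(2)[OF le c1] D2.coeffs_solution(2)[OF le c2]
      using sol(2)[unfolded mean_slope_def] by simp
    show "(\<Sum>i = 1..2. \<omega> i *
      (A i x y 3 * (\<theta> i 3)\<^sup>2 * exp (\<theta> i 3 * y) + A i x y 4 * (\<theta> i 4)\<^sup>2 * exp (- \<theta> i 4 * y))) = 0"
      unfolding sum_1_2 D1.coeffs_curvature[OF le c1] D2.coeffs_curvature[OF le c2] f1(6) f2(6)
      using sol(1)[unfolded curv_def] by (simp only: mult_minus_right)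
  qed
qed

end
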